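(* Consider the nonlinear system $\dot x(t)=f(x(t),w(t))$, $z(t)=h(x(t),w(t))$ under the standing assumptions in the context, with solutions in $\mathfrak{B}^{\mathrm{C}}$. Suppose there exists a function $V_{\mathrm v}:\mathbb{R}^{n_x}\to[0,\infty)$ with $V_{\mathrm v}\in\mathcal{C}_1$ and $V_{\mathrm v}\in\mathcal{Q}_0$ such that $$\frac{d}{dt}V_{\mathrm v}(\dot x(t))\le 0$$ for all $t\ge 0$ and all $\dot x$ that are the first component of an element of $\mathfrak{B}^{\mathrm{VF}}_{\mathscr W}$. Then the system is universally shifted stable (USS). If the inequality holds strictly except when $\dot x(t)=0$, then the system is universally shifted asymptotically stable (USAS).
   Context: System: $\dot x=f(x,w)$, $z=h(x,w)$ on $t\in[0,\infty)$, with $x(t)\in\mathcal X\subseteq\mathbb R^{n_x}$, $w(t)\in\mathcal W\subseteq\mathbb R^{n_w}$, $z(t)\in\mathcal Z\subseteq\mathbb R^{n_z}$, and $f:\mathcal X\times\mathcal W\to\mathbb R^{n_x}$, $h:\mathcal X\times\mathcal W\to\mathcal Z$ in $\mathcal C_1$ ($\mathcal C_n$ = $n$-times continuously differentiable functions). $\mathfrak B$ is the set of all $(x,w,z):[0,\infty)\to\mathcal X\times\mathcal W\times\mathcal Z$ with $x\in\mathcal C_1$ satisfying these equations; solutions are assumed forward complete and unique. $\mathfrak B_{\mathrm w}(\bar w)$ is the subset with $w=\bar w$; $w\equiv w_*$ means $w(t)=w_*$ for all $t\geq 0$. Equilibria: $\mathscr E=\{(x_*,w_*,z_* )\in\mathcal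 X\times\mathcal W\times\mathcal Z: 0=f(x_*,w_* ),\ z_*=h(x_*,w_* )\}$, and $\mathscr X,\mathscr W,\mathscr Z$ are its projections onto the $x_*$, $w_*$, $z_*$ components. Standing assumption: there is a bijection $\kappa:\mathscr W\to\mathscr X$ with $x_*=\kappa(w_* )$ for all equilibrium pairs $(x_*,w_* )$. Differentiable solutions: $\mathfrak B^{\mathrm C}=\{(x,w,z)\in\mathfrak B: x\in\mathcal C_2,\ w,z\in\mathcal C_1\}$ (differentiability also at $t=0$), and $\mathfrak B^{\mathrm C}_{\mathrm w}(\bar w)=\mathfrak B_{\mathrm w}(\bar w)\cap\mathfrak B^{\mathrm C}$. For such a set, $\partial$ denotes the set of time-derivative triples $(\dot x,\dot w,\dot z)$ of its elements. $\mathfrak B^{\mathrm{VF}}_{\mathscr W}=\bigcup_{w_*\in\mathscr W}\partial\mathfrak B^{\mathrm C}_{\mathrm w}(w\equiv w_* )$. Class $\mathcal Q_{x_*}$: a function $V$ is in $\mathcal Q_{x_*}$ if it is positive definite and decrescent with respect to $x_*$, i.e., there exist continuous strictly increasing functions $a,b:[0,\infty)\to[0,\infty)$ with $a(0)=b(0)=0$ and $a(\|x-x_*\|)\le V(x)\le b(\|x-x_*\|)$ for all $x$ in the domain. USS: for each $\epsilon>0$ and each equilibrium pair $(x_*,w_* )$ there is $\delta(\epsilon)>0$ such that $\|x(0)-x_*\|<\delta(\epsilon)$ implies $\|x(t)-x_*\|<\epsilon$ for all $t\ge0$, for all state trajectories $x$ with input $w\equiv w_*$. USAS: USS and, for $w\equiv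 w_*$, $\|x(0)-x_*\|<\delta(\epsilon)$ implies $\lim_{t\to\infty}\|x(t)-x_*\|=0$.
   Formalization: The state set X is additionally assumed locally compact (true for every open or closed X); for arbitrary X the claim fails, e.g. X={x₂≠0}∪{0}, W={0}, f=(x₂,0), V_v=|v|², where 0 is unstable. *)

theory Defs
  imports "HOL-Analysis.Analysis"
begin

(* Signals are total functions on the reals; only their values on [0,\<infinity>) are ever
   constrained or used.  On an arbitrary set S, derivatives are taken relative to S: for open S
   this is the usual notion, and on [0,\<infinity>) it is the one-sided derivative at 0. *)

definition C1_on :: "('a::real_normed_vector \<Rightarrow> 'b::real_normed_vector) \<Rightarrow> 'a set \<Rightarrow> bool" where
  "C1_on F S \<longleftrightarrow> (\<exists>F'::'a \<Rightarrow> 'a \<Rightarrow>\<^sub>L 'b.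
     (\<forall>p\<in>S. (F has_derivative blinfun_apply (F' p)) (at p within S)) \<and> continuous_on S F')"

definition time_deriv :: "(real \<Rightarrow> 'a::real_normed_vector) \<Rightarrow> real \<Rightarrow> 'a" where
  "time_deriv y t = vector_derivative y (at t within {0..})"

definition C1_signal :: "(real \<Rightarrow> 'a::real_normed_vector) \<Rightarrow> bool" where
  "C1_signal y \<longleftrightarrow> C1_on y {0..}"

definition C2_signal :: "(real \<Rightarrow> 'a::real_normed_vector) \<Rightarrow> bool" where
  "C2_signal y \<longleftrightarrow> C1_signal y \<and> C1_signal (time_deriv y)"

type_synonym ('x, 'w, 'z) traj = "(real \<Rightarrow> 'x) \<times> (real \<Rightarrow> 'w) \<times> (real \<Rightarrow> 'z)"

definition behaviour ::
  "'x::real_normed_vector set \<Rightarrow> 'w set \<Rightarrow> 'z set \<Rightarrow> ('x \<times> 'w \<Rightarrow> 'x) \<Rightarrow> ('x \<times> 'w \<Rightarrow> 'z)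
     \<Rightarrow> ('x, 'w, 'z) traj set" where
  "behaviour X W Z f h = {(x, w, z). C1_signal x \<and>
     (\<forall>t\<ge>0. x t \<in> X \<and> w t \<in> W \<and> z t \<in> Z \<and>
        (x has_vector_derivative f (x t, w t)) (at t within {0..}) \<and> z t = h (x t, w t))}"

definition with_input :: "('x, 'w, 'z) traj set \<Rightarrow> (real \<Rightarrow> 'w) \<Rightarrow> ('x, 'w, 'z) traj set" where
  "with_input B wbar = {(x, w, z) \<in> B. \<forall>t\<ge>0. w t = wbar t}"

definition smooth_part ::
  "('x::real_normed_vector, 'w::real_normed_vector, 'z::real_normed_vector) traj set
     \<Rightarrow> ('x, 'w, 'z) traj set" where
  "smooth_part B = {(x, w, z) \<in> B. C2_signal x \<and> C1_signal w \<and> C1_signal z}"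

definition deriv_set ::
  "('x::real_normed_vector, 'w::real_normed_vector, 'z::real_normed_vector) traj set
     \<Rightarrow> ('x, 'w, 'z) traj set" where
  "deriv_set B = (\<lambda>(x, w, z). (time_deriv x, time_deriv w, time_deriv z)) ` B"

definition equilibria ::
  "'x::zero set \<Rightarrow> 'w set \<Rightarrow> 'z set \<Rightarrow> ('x \<times> 'w \<Rightarrow> 'x) \<Rightarrow> ('x \<times> 'w \<Rightarrow> 'z) \<Rightarrow> ('x \<times> 'w \<times> 'z) set" where
  "equilibria X W Z f h =
     {(xs, ws, zs). xs \<in> X \<and> ws \<in> W \<and> zs \<in> Z \<and> 0 = f (xs, ws) \<and> zs = h (xs, ws)}"

definition equil_x :: "('x \<times> 'w \<times> 'z) set \<Rightarrow> 'x set" where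
  "equil_x E = (\<lambda>(xs, ws, zs). xs) ` E"

definition equil_w :: "('x \<times> 'w \<times> 'z) set \<Rightarrow> 'w set" where
  "equil_w E = (\<lambda>(xs, ws, zs). ws) ` E"

definition velocity_behaviour ::
  "('x::real_normed_vector, 'w::real_normed_vector, 'z::real_normed_vector) traj set
     \<Rightarrow> 'w set \<Rightarrow> ('x, 'w, 'z) traj set" where
  "velocity_behaviour B Ws =
     (\<Union>ws\<in>Ws. deriv_set (with_input B (\<lambda>_. ws) \<inter> smooth_part B))"

(* Unique global solvability for every initial state and every continuous input.  Discontinuous
   inputs are left out because they need not admit any C1 state trajectory, and because even for
   f(x,w) = xw an unbounded discontinuous input, w(t) = 2/t for t > 0, violates uniqueness. *)
definition forward_complete_unique ::
  "'x::real_normed_vector set \<Rightarrow> 'w::real_normed_vector set \<Rightarrow> ('x, 'w, 'z) traj set \<Rightarrow> bool" where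
  "forward_complete_unique X W B \<longleftrightarrow>
     (\<forall>x0\<in>X. \<forall>wbar. continuous_on {0..} wbar \<and> (\<forall>t\<ge>0. wbar t \<in> W) \<longrightarrow>
        (\<exists>(x, w, z)\<in>with_input B wbar. x 0 = x0) \<and>
        (\<forall>(x, w, z)\<in>with_input B wbar. \<forall>(x', w', z')\<in>with_input B wbar.
           x 0 = x0 \<and> x' 0 = x0 \<longrightarrow> (\<forall>t\<ge>0. x t = x' t)))"

definition class_Q :: "'a::real_normed_vector set \<Rightarrow> 'a \<Rightarrow> ('a \<Rightarrow> real) \<Rightarrow> bool" where
  "class_Q D xs V \<longleftrightarrow> (\<exists>a b :: real \<Rightarrow> real.
     continuous_on {0..} a \<and> strict_mono_on {0..} a \<and> a 0 = 0 \<and>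
     continuous_on {0..} b \<and> strict_mono_on {0..} b \<and> b 0 = 0 \<and>
     (\<forall>x\<in>D. a (norm (x - xs)) \<le> V x \<and> V x \<le> b (norm (x - xs))))"

definition USS ::
  "('x::real_normed_vector \<times> 'w \<times> 'z) set \<Rightarrow> ('x, 'w, 'z) traj set \<Rightarrow> bool" where
  "USS E B \<longleftrightarrow> (\<forall>\<epsilon>>0. \<forall>(xs, ws, zs)\<in>E. \<exists>\<delta>>0.
     \<forall>(x, w, z)\<in>with_input B (\<lambda>_. ws).
       norm (x 0 - xs) < \<delta> \<longrightarrow> (\<forall>t\<ge>0. norm (x t - xs) < \<epsilon>))"

(* A single \<delta>(\<epsilon>) serves for both stability and attraction. *)
definition USAS ::
  "('x::real_normed_vector \<times> 'w \<times> 'z) set \<Rightarrow> ('x, 'w, 'z) traj set \<Rightarrow> bool" where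
  "USAS E B \<longleftrightarrow> (\<forall>\<epsilon>>0. \<forall>(xs, ws, zs)\<in>E. \<exists>\<delta>>0.
     \<forall>(x, w, z)\<in>with_input B (\<lambda>_. ws).
       norm (x 0 - xs) < \<delta> \<longrightarrow>
         (\<forall>t\<ge>0. norm (x t - xs) < \<epsilon>) \<and> ((\<lambda>t. norm (x t - xs)) \<longlongrightarrow> 0) at_top)"

end

theory Submission
  imports Defs
begin

text \<open>For a constant input \<open>ws\<close> write \<open>g p = f (p, ws)\<close>. The velocity of a trajectory \<open>x\<close> is
  \<open>g (x t)\<close>, so \<open>U p = V (g p)\<close> is a function of the state that does not increase along
  trajectories, and it vanishes only at the equilibrium since \<open>g\<close> does. Hence \<open>U\<close> is a
  Lyapunov function. Its orbital derivative \<open>G\<close> is continuous; since a trajectory starts at every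
  state, the strict inequality at time 0 gives \<open>G < 0\<close> away from the equilibrium, and compactness
  makes this bound uniform away from it.\<close>

section \<open>Calculus of C1 maps relative to an arbitrary set\<close>

lemma C1_onE:
  assumes "C1_on F S"
  obtains F' where "\<And>p. p \<in> S \<Longrightarrow> (F has_derivative blinfun_apply (F' p)) (at p within S)"
    and "continuous_on S F'"
  using assms unfolding C1_on_def by blast

lemma C1_on_imp_continuous_on: "C1_on F S \<Longrightarrow> continuous_on S F"
  by (meson C1_onE has_derivative_continuous_on)

text \<open>Chain rule relative to sets: since \<open>F\<close> maps \<open>S\<close> into
  \<open>T\<close>, the derivative of \<open>G\<close> within \<open>T\<close> restricts to the
  image of \<open>S\<close>. The composed derivatives again form a continuous family because
  composition of bounded linear maps is continuous.\<close>

lemma C1_on_compose: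
  assumes "C1_on G T" and "C1_on F S" and "F ` S \<subseteq> T"
  shows "C1_on (\<lambda>p. G (F p)) S"
proof -
  obtain G' where G': "\<And>p. p \<in> T \<Longrightarrow> (G has_derivative blinfun_apply (G' p)) (at p within T)"
    and cG': "continuous_on T G'"
    using assms(1) by (rule C1_onE) blast
  obtain F' where F': "\<And>p. p \<in> S \<Longrightarrow> (F has_derivative blinfun_apply (F' p)) (at p within S)"
    and cF': "continuous_on S F'"
    using assms(2) by (rule C1_onE) blast
  have "((\<lambda>p. G (F p)) has_derivative blinfun_apply (G' (F p) o\<^sub>L F' p)) (at p within S)"
    if p: "p \<in> S" for p
  proof -
    have "(G has_derivative blinfun_apply (G' (F p))) (at (F p) within F ` S)"
      using G'[of "F p"] p assms(3) by (blast intro: has_derivative_subset)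
    from has_derivative_in_compose[OF F'[OF p] this]
    show ?thesis by (simp add: blinfun_apply_blinfun_compose[abs_def])
  qed
  moreover have "continuous_on S (\<lambda>p. G' (F p) o\<^sub>L F' p)"
    by (intro continuous_intros cF'
        continuous_on_compose2[OF cG' C1_on_imp_continuous_on[OF assms(2)] assms(3)])
  ultimately show ?thesis
    unfolding C1_on_def by (intro exI[of _ "\<lambda>p. G' (F p) o\<^sub>L F' p"]) blast
qed

lemma C1_on_cong:
  assumes "C1_on F S" and "\<And>p. p \<in> S \<Longrightarrow> F p = H p"
  shows "C1_on H S"
  using assms unfolding C1_on_def by (metis has_derivative_transform)

lemma C1_on_const: "C1_on (\<lambda>_. c) S"
  unfolding C1_on_def by (intro exI[of _ "\<lambda>_. 0"]) (simp add: zero_blinfun.rep_eq)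

lemma C1_on_Pair_const: "C1_on (\<lambda>p. (p, c)) S"
proof -
  have bl: "bounded_linear (\<lambda>v. (v, 0))"
    by (intro bounded_linear_Pair bounded_linear_ident bounded_linear_zero)
  have "((\<lambda>p. (p, c)) has_derivative blinfun_apply (Blinfun (\<lambda>v. (v, 0)))) (at p within S)" for p
    unfolding bounded_linear_Blinfun_apply[OF bl]
    by (intro has_derivative_Pair has_derivative_ident has_derivative_const)
  then show ?thesis
    unfolding C1_on_def by (intro exI[of _ "\<lambda>_. Blinfun (\<lambda>v. (v, 0))"]) simp
qed

text \<open>Every \<open>t \<ge> 0\<close>, including the endpoint 0, can be approached from the
  right inside \<open>{0..}\<close>, so the derivative relative to this half-line is unique.\<close>

lemma time_deriv_eq:
  assumes "(y has_vector_derivative d) (at t within {0..})" and "0 \<le> t"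
  shows "time_deriv y t = d"
  unfolding time_deriv_def
proof (rule vector_derivative_within[OF _ assms(1)])
  have "at t within {t<..} \<noteq> bot"
    using trivial_limit_at_right_real[of t] by simp
  moreover have "at t within {t<..} \<le> at t within {0..}"
    using assms(2) by (intro at_le) auto
  ultimately show "at t within {0..} \<noteq> bot"
    using bot.extremum_uniqueI by fastforce
qed

section \<open>Lyapunov's direct method\<close>

lemma compact_pos_lower_bound:
  fixes U :: "'a::topological_space \<Rightarrow> real"
  assumes "compact C" and "continuous_on C U" and "\<And>x. x \<in> C \<Longrightarrow> 0 < U x"
  obtains m where "0 < m" and "\<And>x. x \<in> C \<Longrightarrow> m \<le> U x"
proof (cases "C = {}")
  case True
  \<comment> \<open>\<open>C\<close> may be empty in the applications, for instance when a sphere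
    misses the state set; 1 is then an arbitrary positive bound.\<close>
  then show ?thesis using that[of 1] by simp
next
  case False
  then obtain c where "c \<in> C" "\<And>x. x \<in> C \<Longrightarrow> U c \<le> U x"
    using continuous_attains_inf[OF assms(1) _ assms(2)] by blast
  then show ?thesis using that[of "U c"] assms(3) by blast
qed

text \<open>Mean value theorem on \<open>{s..t}\<close>. With \<open>k = 0\<close> it yields
  monotonicity, with \<open>k > 0\<close> decay at a linear rate.\<close>

lemma decay_of_derivative_le:
  fixes u :: "real \<Rightarrow> real"
  assumes "\<And>t. 0 \<le> t \<Longrightarrow> (u has_real_derivative u' t) (at t within {0..})"
    and "\<And>t. 0 \<le> t \<Longrightarrow> u' t \<le> - k"
    and "0 \<le> s" and "s \<le> t"
  shows "u t \<le> u s - k * (t - s)"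
proof (cases "s = t")
  case False
  then have st: "s < t" using assms(4) by simp
  have "\<exists>r\<in>{s<..<t}. u t - u s = u' r * (t - s)"
  proof (rule mvt_simple[OF st, of u "\<lambda>r d. u' r * d"])
    fix r assume "s \<le> r" "r \<le> t"
    then have "(u has_real_derivative u' r) (at r within {s..t})"
      using assms(1)[of r] assms(3) by (auto intro: has_field_derivative_subset)
    then show "(u has_derivative (\<lambda>d. u' r * d)) (at r within {s..t})"
      by (simp add: has_field_derivative_def)
  qed
  then obtain r where "r \<in> {s<..<t}" and ut: "u t - u s = u' r * (t - s)"
    by blast
  then have r: "0 \<le> r" using assms(3) by simp
  have "u' r * (t - s) \<le> - k * (t - s)"
    using assms(2)[OF r] st by (intro mult_right_mono) auto
  with ut show ?thesis by simp
qed simp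

text \<open>Leaving a small ball means crossing its sphere, where \<open>U\<close> is at least some
  \<open>m > 0\<close>; but \<open>U\<close> starts below \<open>m\<close> and never exceeds its
  initial value. Local compactness makes the sphere compact within \<open>S\<close>, which need be
  neither open nor closed. The compact \<open>K\<close> is returned so that attraction can be proved
  inside it with the same \<open>\<delta>\<close>.\<close>

lemma lyapunov_stable:
  fixes S :: "'a::euclidean_space set" and U :: "'a \<Rightarrow> real"
  assumes "locally compact S" and "xs \<in> S" and U: "continuous_on S U"
    and "U xs = 0" and pos: "\<And>x. x \<in> S \<Longrightarrow> x \<noteq> xs \<Longrightarrow> 0 < U x" and "0 < \<epsilon>"
  obtains \<delta> K where "0 < \<delta>" and "compact K" and "K \<subseteq> ball xs \<epsilon> \<inter> S"
    and "\<And>(x :: real \<Rightarrow> 'a) t. \<lbrakk>continuous_on {0..} x; x ` {0..} \<subseteq> S;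
            \<And>s. 0 \<le> s \<Longrightarrow> U (x s) \<le> U (x 0); dist xs (x 0) < \<delta>; 0 \<le> t\<rbrakk> \<Longrightarrow> x t \<in> K"
proof -
  obtain e where e: "0 < e" "closed (cball xs e \<inter> S)"
    using assms(1,2) by (auto simp: locally_compact_Int_cball)
  \<comment> \<open>The bound \<open>e\<close> makes the part of the closed ball in \<open>S\<close>
    compact; \<open>\<epsilon> / 2\<close> keeps that ball inside the open ball of radius
    \<open>\<epsilon>\<close>.\<close>
  define r where "r = min e (\<epsilon> / 2)"
  define K where "K = cball xs r \<inter> S"
  have r: "0 < r" "r < \<epsilon>" "r \<le> e" using e(1) assms(6) by (auto simp: r_def)
  have "K = cball xs r \<inter> (cball xs e \<inter> S)" using r by (auto simp: K_def)
  then have K: "compact K" using e(2) by (simp add: compact_Int_closed)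
  have sphere: "sphere xs r \<inter> S = sphere xs r \<inter> K" by (auto simp: K_def)
  have "compact (sphere xs r \<inter> S)"
    unfolding sphere using K by (simp add: closed_Int_compact)
  moreover have "continuous_on (sphere xs r \<inter> S) U"
    using U by (rule continuous_on_subset) simp
  moreover have "0 < U x" if "x \<in> sphere xs r \<inter> S" for x
    using that r by (intro pos) auto
  ultimately obtain m where m: "0 < m" "\<And>x. x \<in> sphere xs r \<inter> S \<Longrightarrow> m \<le> U x"
    using compact_pos_lower_bound by blast
  obtain d where d: "0 < d" "\<And>x. x \<in> S \<Longrightarrow> dist x xs < d \<Longrightarrow> dist (U x) (U xs) < m"
    using U assms(2) m(1) unfolding continuous_on_iff by meson
  \<comment> \<open>The bound \<open>d\<close> makes \<open>U\<close> start below \<open>m\<close>;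
    the bound \<open>r\<close> makes the trajectory start strictly inside the sphere, so that the
    intermediate value theorem yields a crossing.\<close>
  show ?thesis
  proof (rule that[of "min d r" K])
    fix x :: "real \<Rightarrow> 'a" and t :: real
    assume x: "continuous_on {0..} x" "x ` {0..} \<subseteq> S"
      and mono: "\<And>s. 0 \<le> s \<Longrightarrow> U (x s) \<le> U (x 0)"
      and x0: "dist xs (x 0) < min d r" and t: "0 \<le> t"
    have "x 0 \<in> S" using x(2) by auto
    then have "dist (U (x 0)) (U xs) < m"
      using d(2)[of "x 0"] x0 by (simp add: dist_commute)
    then have Ux0: "U (x 0) < m" using assms(4) by (simp add: dist_real_def)
    show "x t \<in> K"
    proof (rule ccontr)
      assume "x t \<notin> K"
      then have "r \<le> dist xs (x t)" using x(2) t by (auto simp: K_def)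
      moreover have "continuous_on {0..t} (\<lambda>s. dist xs (x s))"
        by (intro continuous_intros continuous_on_subset[OF x(1)]) auto
      ultimately obtain s where s: "0 \<le> s" "dist xs (x s) = r"
        using IVT'[of "\<lambda>s. dist xs (x s)" 0 r t] x0 t by auto
      then have "m \<le> U (x s)" using x(2) by (intro m(2)) auto
      with mono[OF s(1)] Ux0 show False by simp
    qed
  next
    show "K \<subseteq> ball xs \<epsilon> \<inter> S" using r by (auto simp: K_def)
  qed (use d(1) r(1) K in simp_all)
qed

text \<open>Let \<open>m > 0\<close> bound \<open>U\<close> from below outside the
  \<open>\<eta>\<close>-ball. If \<open>U\<close> never fell below \<open>m\<close>, the trajectory
  would stay in a compact set where \<open>G\<close> is at most some \<open>-k < 0\<close>, and
  \<open>U\<close> would become negative. Once below \<open>m\<close>, \<open>U\<close> stays there,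
  which traps the trajectory in the ball.\<close>

lemma lyapunov_attractive:
  fixes K :: "'a::metric_space set" and U G :: "'a \<Rightarrow> real"
  assumes "compact K" and U: "continuous_on K U" and G: "continuous_on K G"
    and "U xs = 0" and pos: "\<And>p. p \<in> K \<Longrightarrow> p \<noteq> xs \<Longrightarrow> 0 < U p"
    and G_le: "\<And>p. p \<in> K \<Longrightarrow> G p \<le> 0" and neg: "\<And>p. p \<in> K \<Longrightarrow> p \<noteq> xs \<Longrightarrow> G p < 0"
    and x: "\<And>t. 0 \<le> t \<Longrightarrow> x t \<in> K"
    and deriv: "\<And>t. 0 \<le> t \<Longrightarrow> ((\<lambda>s. U (x s)) has_real_derivative G (x t)) (at t within {0..})"
  shows "(x \<longlongrightarrow> xs) at_top"
proof (rule tendstoI)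
  fix \<eta> :: real assume \<eta>: "0 < \<eta>"
  have U_nonneg: "0 \<le> U p" if "p \<in> K" for p
    using pos[OF that] assms(4) by (cases "p = xs") auto
  define C where "C = K \<inter> {p. \<eta> \<le> dist p xs}"
  have "compact C"
    unfolding C_def
    by (intro compact_Int_closed assms(1) closed_Collect_le continuous_intros)
  moreover have "continuous_on C U" using U by (rule continuous_on_subset) (simp add: C_def)
  moreover have "0 < U p" if "p \<in> C" for p using that \<eta> by (intro pos) (auto simp: C_def)
  ultimately obtain m where m: "0 < m" "\<And>p. p \<in> C \<Longrightarrow> m \<le> U p"
    using compact_pos_lower_bound by blast
  \<comment> \<open>\<open>D\<close> avoids \<open>xs\<close> because \<open>U xs = 0 < m\<close>;
    hence \<open>G\<close> has a uniform negative upper bound on it.\<close>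
  define D where "D = K \<inter> U -` {m..}"
  have "compact D"
    unfolding D_def using assms(1) U
    by (metis closed_atLeast closedin_compact continuous_closedin_preimage)
  moreover have "continuous_on D (\<lambda>p. - G p)"
    by (intro continuous_intros continuous_on_subset[OF G]) (simp add: D_def)
  moreover have "0 < - G p" if "p \<in> D" for p
    using that m(1) assms(4) by (cases "p = xs") (auto simp: D_def dest: neg)
  ultimately obtain k where k: "0 < k" "\<And>p. p \<in> D \<Longrightarrow> k \<le> - G p"
    using compact_pos_lower_bound by blast
  have "\<exists>T\<ge>0. U (x T) < m"
  proof (rule ccontr)
    assume "\<not> ?thesis"
    then have "G (x t) \<le> - k" if "0 \<le> t" for t
      using k(2)[of "x t"] x[OF that] that by (force simp: D_def)
    then have decay: "U (x t) \<le> U (x 0) - k * (t - 0)" if "0 \<le> t" for t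
      using decay_of_derivative_le[OF deriv, of k 0 t] that by simp
    \<comment> \<open>By this time, decay at rate \<open>k\<close> would have brought
      \<open>U\<close> down to -1 or lower.\<close>
    define t where "t = (U (x 0) + 1) / k"
    have "0 \<le> t" using U_nonneg[OF x[of 0]] k(1) by (simp add: t_def)
    moreover have "k * t = U (x 0) + 1" using k(1) by (simp add: t_def)
    ultimately show False using decay[of t] U_nonneg[OF x[of t]] by simp
  qed
  then obtain T where T: "0 \<le> T" "U (x T) < m" by blast
  have "dist (x t) xs < \<eta>" if "T \<le> t" for t
  proof (rule ccontr)
    assume "\<not> dist (x t) xs < \<eta>"
    then have "m \<le> U (x t)" using x[of t] T(1) that by (intro m(2)) (simp add: C_def)
    moreover have "U (x t) \<le> U (x T)"
      using decay_of_derivative_le[OF deriv, of 0 T t] G_le x T(1) that by simp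
    ultimately show False using T(2) by simp
  qed
  then show "\<forall>\<^sub>F t in at_top. dist (x t) xs < \<eta>"
    by (auto simp: eventually_at_top_linorder)
qed

section \<open>Trajectories under a constant input\<close>

lemma time_deriv_behaviour:
  assumes "(x, w, z) \<in> with_input (behaviour X W Z f h) (\<lambda>_. ws)" and "0 \<le> t"
  shows "time_deriv x t = f (x t, ws)"
  using assms by (auto simp: with_input_def behaviour_def intro!: time_deriv_eq)

text \<open>Bootstrapping: the velocity \<open>f (x t, ws)\<close> of a solution is a composition of
  C1 maps, so \<open>x\<close> is twice continuously differentiable. The velocity condition
  therefore covers every solution with constant equilibrium input.\<close>

lemma with_constant_input_smooth:
  assumes f: "C1_on f (X \<times> W)" and h: "C1_on h (X \<times> W)"
    and sol: "(x, w, z) \<in> with_input (behaviour X W Z f h) (\<lambda>_. ws)"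
  shows "(x, w, z) \<in> smooth_part (behaviour X W Z f h)"
proof -
  have x: "C1_on x {0..}" and xX: "x ` {0..} \<subseteq> X" and w: "\<And>t. 0 \<le> t \<Longrightarrow> w t = ws"
    and wW: "ws \<in> W" and z: "\<And>t. 0 \<le> t \<Longrightarrow> z t = h (x t, ws)"
    using sol by (auto simp: with_input_def behaviour_def C1_signal_def dest: spec[of _ 0])
  have xw: "C1_on (\<lambda>t. (x t, ws)) {0..}"
    using C1_on_compose[OF C1_on_Pair_const[of ws X] x xX] .
  have sub: "(\<lambda>t. (x t, ws)) ` {0..} \<subseteq> X \<times> W" using xX wW by auto
  have "C1_on (time_deriv x) {0..}"
    using C1_on_compose[OF f xw sub] by (rule C1_on_cong) (simp add: time_deriv_behaviour[OF sol])
  moreover have "C1_on z {0..}"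
    using C1_on_compose[OF h xw sub] by (rule C1_on_cong) (simp add: z)
  moreover have "C1_on w {0..}"
    using C1_on_const[of ws] by (rule C1_on_cong) (simp add: w)
  ultimately show ?thesis
    using sol x by (simp add: smooth_part_def with_input_def C2_signal_def C1_signal_def)
qed

text \<open>\<open>G p\<close> is the derivative of \<open>V (f (p, ws))\<close> in the direction
  \<open>f (p, ws)\<close>. As a function of the state alone, it carries sign information from one
  trajectory to any other through the same state.\<close>

lemma velocity_orbital_derivative:
  fixes f :: "'x::real_normed_vector \<times> 'w::real_normed_vector \<Rightarrow> 'x"
  assumes f: "C1_on f (X \<times> W)" and V: "C1_on V UNIV" and ws: "ws \<in> W"
  obtains G :: "'x \<Rightarrow> real" where "continuous_on X G"
    and "\<And>x w z t. \<lbrakk>(x, w, z) \<in> with_input (behaviour X W Z f h) (\<lambda>_. ws); 0 \<le> t\<rbrakk> \<Longrightarrow>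
           ((\<lambda>s. V (f (x s, ws))) has_real_derivative G (x t)) (at t within {0..})"
    and "\<And>x w z t. \<lbrakk>(x, w, z) \<in> with_input (behaviour X W Z f h) (\<lambda>_. ws); 0 \<le> t\<rbrakk> \<Longrightarrow>
           time_deriv (\<lambda>s. V (time_deriv x s)) t = G (x t)"
proof -
  have g: "C1_on (\<lambda>p. f (p, ws)) X"
    using C1_on_compose[OF f C1_on_Pair_const[of ws X]] ws by auto
  obtain U' where
    U': "\<And>p. p \<in> X \<Longrightarrow> ((\<lambda>p. V (f (p, ws))) has_derivative blinfun_apply (U' p)) (at p within X)"
    and cU': "continuous_on X U'"
    using C1_onE[OF C1_on_compose[OF V g subset_UNIV]] by blast
  define G where "G p = U' p (f (p, ws))" for p
  have deriv: "((\<lambda>s. V (f (x s, ws))) has_real_derivative G (x t)) (at t within {0..})"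
    if sol: "(x, w, z) \<in> with_input (behaviour X W Z f h) (\<lambda>_. ws)" and t: "0 \<le> t" for x w z t
  proof -
    have xX: "x ` {0..} \<subseteq> X"
      and x': "(x has_vector_derivative f (x t, ws)) (at t within {0..})"
      using sol t by (auto simp: with_input_def behaviour_def dest: spec[of _ t])
    \<comment> \<open>The chain rule asks for the derivative within the image of the trajectory, a
      subset of \<open>X\<close>.\<close>
    have "((\<lambda>p. V (f (p, ws))) has_derivative blinfun_apply (U' (x t))) (at (x t) within x ` {0..})"
      using U'[of "x t"] xX t by (auto intro: has_derivative_subset)
    from vector_derivative_diff_chain_within[OF x' this]
    show ?thesis
      by (simp add: G_def o_def has_real_derivative_iff_has_vector_derivative)
  qed
  show ?thesis
  proof (rule that[of G])
    show "continuous_on X G"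
      unfolding G_def by (intro continuous_intros cU' C1_on_imp_continuous_on[OF g])
    fix x w z t
    assume sol: "(x, w, z) \<in> with_input (behaviour X W Z f h) (\<lambda>_. ws)" and t: "(0::real) \<le> t"
    show "((\<lambda>s. V (f (x s, ws))) has_real_derivative G (x t)) (at t within {0..})"
      by (rule deriv[OF sol t])
    then have "((\<lambda>s. V (time_deriv x s)) has_vector_derivative G (x t)) (at t within {0..})"
      unfolding has_real_derivative_iff_has_vector_derivative
      by (rule has_vector_derivative_transform[rotated 2])
        (simp_all add: t time_deriv_behaviour[OF sol])
    then show "time_deriv (\<lambda>s. V (time_deriv x s)) t = G (x t)"
      using t by (rule time_deriv_eq)
  qed
qed

section \<open>Universal shifted stability from a Lyapunov function of the velocity\<close>

theorem theorem4:
  fixes X :: "(real ^ 'nx) set" and W :: "(real ^ 'nw) set" and Z :: "(real ^ 'nz) set"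
    and f :: "(real ^ 'nx) \<times> (real ^ 'nw) \<Rightarrow> real ^ 'nx"
    and h :: "(real ^ 'nx) \<times> (real ^ 'nw) \<Rightarrow> real ^ 'nz"
    and \<kappa> :: "real ^ 'nw \<Rightarrow> real ^ 'nx"
    and V :: "real ^ 'nx \<Rightarrow> real"
  defines "B \<equiv> behaviour X W Z f h"
    and "E \<equiv> equilibria X W Z f h"
  assumes X_lc: "locally compact X"
    and f_C1: "C1_on f (X \<times> W)"
    and h_C1: "C1_on h (X \<times> W)" and h_Z: "h ` (X \<times> W) \<subseteq> Z"
    and wellposed: "forward_complete_unique X W B"
    and \<kappa>_bij: "bij_betw \<kappa> (equil_w E) (equil_x E)"
    and \<kappa>_eq: "\<forall>(xs, ws, zs)\<in>E. xs = \<kappa> ws"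
    and V_nonneg: "\<forall>v. V v \<ge> 0"
    and V_C1: "C1_on V UNIV"
    and V_Q: "class_Q UNIV 0 V"
    and V_decr: "\<forall>(dx, dw, dz)\<in>velocity_behaviour B (equil_w E). \<forall>t\<ge>0.
                   time_deriv (\<lambda>s. V (dx s)) t \<le> 0"
  shows "USS E B \<and>
    ((\<forall>(dx, dw, dz)\<in>velocity_behaviour B (equil_w E). \<forall>t\<ge>0.
        dx t \<noteq> 0 \<longrightarrow> time_deriv (\<lambda>s. V (dx s)) t < 0) \<longrightarrow> USAS E B)"
proof -
  \<comment> \<open>The lower bound \<open>a\<close> is positive at nonzero vectors; at 0 both
    bounds vanish.\<close>
  have V_eq_0_iff: "V v = 0 \<longleftrightarrow> v = 0" for v
  proof -
    obtain a b where a: "strict_mono_on {0..} a" "a 0 = (0::real)" "a (norm v) \<le> V v"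
      and b: "b 0 = (0::real)" "V v \<le> b (norm v)"
      using V_Q unfolding class_Q_def by fastforce
    have "a 0 < a (norm v)" if "v \<noteq> 0"
      using strict_mono_onD[OF a(1), of 0 "norm v"] that by simp
    then show ?thesis
      using a(2,3) b by (cases "v = 0") auto
  qed
  \<comment> \<open>The strict inequality is a premise of the convergence claim only, placed after
    the choice of \<open>\<delta>\<close>; both stability notions then follow from this one
    statement.\<close>
  have local_result:
    "\<exists>\<delta>>0. \<forall>(x, w, z)\<in>with_input B (\<lambda>_. ws). norm (x 0 - xs) < \<delta> \<longrightarrow>
       (\<forall>t\<ge>0. norm (x t - xs) < \<epsilon>) \<and>
       ((\<forall>(dx, dw, dz)\<in>velocity_behaviour B (equil_w E). \<forall>t\<ge>0.
          dx t \<noteq> 0 \<longrightarrow> time_deriv (\<lambda>s. V (dx s)) t < 0) \<longrightarrow>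
        ((\<lambda>t. norm (x t - xs)) \<longlongrightarrow> 0) at_top)"
    if \<epsilon>: "0 < \<epsilon>" and eq: "(xs, ws, zs) \<in> E" for \<epsilon> xs ws zs
  proof -
    have xs: "xs \<in> X" and ws: "ws \<in> W" and fs: "f (xs, ws) = 0" and wsE: "ws \<in> equil_w E"
      using eq by (auto simp: E_def equilibria_def equil_w_def intro: rev_image_eqI)
    \<comment> \<open>A zero of the vector field is an equilibrium state, with output in
      \<open>Z\<close> by \<open>h_Z\<close>, and \<open>\<kappa>\<close> assigns just one state to
      \<open>ws\<close>.\<close>
    have unique: "p = xs" if "p \<in> X" "f (p, ws) = 0" for p
    proof -
      have in_E: "(p, ws, h (p, ws)) \<in> E"
        using that ws h_Z by (auto simp: E_def equilibria_def)
      then show ?thesis using bspec[OF \<kappa>_eq in_E] bspec[OF \<kappa>_eq eq] by simp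
    qed
    obtain G where cG: "continuous_on X G"
      and deriv: "\<And>x w z t. \<lbrakk>(x, w, z) \<in> with_input B (\<lambda>_. ws); 0 \<le> t\<rbrakk> \<Longrightarrow>
           ((\<lambda>s. V (f (x s, ws))) has_real_derivative G (x t)) (at t within {0..})"
      and td: "\<And>x w z t. \<lbrakk>(x, w, z) \<in> with_input B (\<lambda>_. ws); 0 \<le> t\<rbrakk> \<Longrightarrow>
           time_deriv (\<lambda>s. V (time_deriv x s)) t = G (x t)"
      unfolding B_def by (rule velocity_orbital_derivative[OF f_C1 V_C1 ws]) blast
    have vel: "(time_deriv x, time_deriv w, time_deriv z) \<in> velocity_behaviour B (equil_w E)"
      if "(x, w, z) \<in> with_input B (\<lambda>_. ws)" for x w z
    proof -
      have "(x, w, z) \<in> with_input B (\<lambda>_. ws) \<inter> smooth_part B"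
        using that with_constant_input_smooth[OF f_C1 h_C1] unfolding B_def by blast
      then show ?thesis
        using wsE unfolding velocity_behaviour_def deriv_set_def
        by (intro UN_I[of ws] image_eqI[of _ _ "(x, w, z)"]) simp_all
    qed
    \<comment> \<open>A constant input is continuous, so well-posedness starts a trajectory at every
      state; the sign of \<open>G\<close> at \<open>p\<close> can then be read off at time
      0.\<close>
    have start: "\<exists>x w z. (x, w, z) \<in> with_input B (\<lambda>_. ws) \<and> x 0 = p" if "p \<in> X" for p
    proof -
      have "continuous_on {0..} (\<lambda>_::real. ws) \<and> (\<forall>t\<ge>0::real. ws \<in> W)" using ws by simp
      from wellposed[unfolded forward_complete_unique_def, rule_format, OF that this]
      have "\<exists>(x, w, z)\<in>with_input B (\<lambda>_. ws). x 0 = p"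
        by (rule conjunct1)
      then show ?thesis by auto
    qed
    have G_le: "G p \<le> 0" if p: "p \<in> X" for p
    proof -
      obtain x w z where s: "(x, w, z) \<in> with_input B (\<lambda>_. ws)" "x 0 = p"
        using start[OF p] by blast
      then show ?thesis using bspec[OF V_decr vel[OF s(1)]] td[OF s(1), of 0] by auto
    qed
    let ?U = "\<lambda>p. V (f (p, ws))"
    have cU: "continuous_on X ?U"
      using C1_on_imp_continuous_on[OF C1_on_compose[OF V_C1
          C1_on_compose[OF f_C1 C1_on_Pair_const[of ws X]]]] ws by auto
    have U0: "?U xs = 0" using V_eq_0_iff fs by simp
    \<comment> \<open>\<open>?U\<close> vanishes only where the velocity does, hence only at
      \<open>xs\<close> by \<open>unique\<close>.\<close>
    have Upos: "0 < ?U p" if "p \<in> X" "p \<noteq> xs" for p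
      using V_eq_0_iff[of "f (p, ws)"] V_nonneg unique[of p] that
      by (auto simp: less_le)
    obtain \<delta> K where \<delta>: "0 < \<delta>" and K: "compact K" "K \<subseteq> ball xs \<epsilon> \<inter> X"
      and stays: "\<And>(x :: real \<Rightarrow> real ^ 'nx) t. \<lbrakk>continuous_on {0..} x; x ` {0..} \<subseteq> X;
            \<And>s. 0 \<le> s \<Longrightarrow> ?U (x s) \<le> ?U (x 0); dist xs (x 0) < \<delta>; 0 \<le> t\<rbrakk> \<Longrightarrow> x t \<in> K"
      by (rule lyapunov_stable[OF X_lc xs cU U0 Upos \<epsilon>]) blast+
    have KX: "K \<subseteq> X" using K(2) by blast
    have conclusion: "(\<forall>t\<ge>0. norm (x t - xs) < \<epsilon>) \<and>
       ((\<forall>(dx, dw, dz)\<in>velocity_behaviour B (equil_w E). \<forall>t\<ge>0.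
          dx t \<noteq> 0 \<longrightarrow> time_deriv (\<lambda>s. V (dx s)) t < 0) \<longrightarrow>
        ((\<lambda>t. norm (x t - xs)) \<longlongrightarrow> 0) at_top)"
      if sol: "(x, w, z) \<in> with_input B (\<lambda>_. ws)" and x0: "norm (x 0 - xs) < \<delta>" for x w z
    proof -
      have xX: "x ` {0..} \<subseteq> X" and cx: "continuous_on {0..} x"
        using sol by (auto simp: B_def with_input_def behaviour_def C1_signal_def
            intro: C1_on_imp_continuous_on)
      \<comment> \<open>The case \<open>k = 0\<close> of the decay estimate, with
        \<open>G \<le> 0\<close> on all of \<open>X\<close>.\<close>
      have "?U (x s) \<le> ?U (x 0)" if "0 \<le> s" for s
        using decay_of_derivative_le[OF deriv[OF sol], of 0 0 s] G_le xX that by auto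
      then have xK: "x t \<in> K" if "0 \<le> t" for t
        using stays[OF cx xX] x0 that by (simp add: dist_norm norm_minus_commute)
      show ?thesis
      proof (intro conjI allI impI)
        show "norm (x t - xs) < \<epsilon>" if "0 \<le> t" for t
          using xK[OF that] K(2) by (auto simp: dist_norm norm_minus_commute)
        assume strict: "\<forall>(dx, dw, dz)\<in>velocity_behaviour B (equil_w E). \<forall>t\<ge>0.
          dx t \<noteq> 0 \<longrightarrow> time_deriv (\<lambda>s. V (dx s)) t < 0"
        \<comment> \<open>A trajectory from \<open>p\<close> has initial velocity
          \<open>f (p, ws)\<close>, nonzero by \<open>unique\<close>, so the strict inequality
          applies at time 0.\<close>
        have G_neg: "G p < 0" if p: "p \<in> X" "p \<noteq> xs" for p
        proof -
          obtain x w z where s: "(x, w, z) \<in> with_input B (\<lambda>_. ws)" "x 0 = p"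
            using start[OF p(1)] by blast
          then have "time_deriv x 0 \<noteq> 0"
            using time_deriv_behaviour[of x w z X W Z f h ws 0] unique p by (auto simp: B_def)
          then show ?thesis using bspec[OF strict vel[OF s(1)]] td[OF s(1), of 0] s(2) by auto
        qed
        have "(x \<longlongrightarrow> xs) at_top"
          using KX by (intro lyapunov_attractive[OF K(1) continuous_on_subset[OF cU KX]
              continuous_on_subset[OF cG KX] U0]) (auto intro: Upos G_le G_neg xK deriv[OF sol])
        then show "((\<lambda>t. norm (x t - xs)) \<longlongrightarrow> 0) at_top"
          by (simp add: tendsto_norm_zero LIM_zero)
      qed
    qed
    show ?thesis using \<delta> conclusion by (intro exI[of _ \<delta>]) auto
  qed
  show ?thesis
  proof (intro conjI impI)
    show "USS E B"
      unfolding USS_def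
    proof (intro allI impI ballI, clarify)
      fix \<epsilon> :: real and xs ws zs
      assume "0 < \<epsilon>" "(xs, ws, zs) \<in> E"
      from local_result[OF this] show "\<exists>\<delta>>0. \<forall>(x, w, z)\<in>with_input B (\<lambda>_. ws).
          norm (x 0 - xs) < \<delta> \<longrightarrow> (\<forall>t\<ge>0. norm (x t - xs) < \<epsilon>)"
        by (elim ex_forward) blast
    qed
    assume strict: "\<forall>(dx, dw, dz)\<in>velocity_behaviour B (equil_w E). \<forall>t\<ge>0.
        dx t \<noteq> 0 \<longrightarrow> time_deriv (\<lambda>s. V (dx s)) t < 0"
    show "USAS E B"
      unfolding USAS_def
    proof (intro allI impI ballI, clarify)
      fix \<epsilon> :: real and xs ws zs
      assume "0 < \<epsilon>" "(xs, ws, zs) \<in> E"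
      from local_result[OF this] strict show "\<exists>\<delta>>0. \<forall>(x, w, z)\<in>with_input B (\<lambda>_. ws).
          norm (x 0 - xs) < \<delta> \<longrightarrow> (\<forall>t\<ge>0. norm (x t - xs) < \<epsilon>) \<and>
            ((\<lambda>t. norm (x t - xs)) \<longlongrightarrow> 0) at_top"
        by simp
    qed
  qed
qed

end
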